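(* (Dominated Convergence Theorem.) Let $X$ be a Banach space over $\mathbb{C}$, $(\Omega,\Sigma)$ a measurable space, and $\mu=\{\mu_{\Lambda,x} \mid \Lambda\in X^*,\ x\in X\}$ an operator projection family. If $(f_n)_{n\in\mathbb{N}}$ is a sequence of functions in $L^1(\mu)$ such that $f_n\to f$ pointwise and there exists $g\in L^1(\mu)$ such that $|f_n|\leq g$ for each $n\in\mathbb{N}$, then $f\in L^1(\mu)$ and, for each $x\in X$, $$\int f_n\,d\mu(x)\to\int f\,d\mu(x)$$ in the weak-$*$ topology of $X^{**}$.
   Context: $\mathcal{M}(\Omega)$ is the space of complex measures on $(\Omega,\Sigma)$. A net $(\mu_i)$ in $\mathcal{M}(\Omega)$ converges setwise to $\mu$ if $\mu_i(E)\to\mu(E)$ for every $E\in\Sigma$. An operator projection family is a collection $\{\mu_{\Lambda,x} \mid \Lambda\in X^*,\ x\in X\}\subset\mathcal{M}(\Omega)$ such that (1) $(\Lambda,x)\mapsto\mu_{\Lambda,x}$ is bilinear from $X^*\times X$ to $\mathcal{M}(\Omega)$; (2) if nets $\Lambda_i\to\Lambda$ in $X^*$ and $x_j\to x$ in $X$ converge in norm, then $\mu_{\Lambda_i,x}\to\mu_{\Lambda,x}$ and $\mu_{\Lambda,x_j}\to\mu_{\Lambda,x}$ setwise. A measurable $f\colon\Omega\to\mathbb{C}$ belongs to $L^1(\mu)$ if $f\in L^1(\mu_{\Lambda,x})$ (that is, $\int|f|\,d|\mu_{\Lambda,x}|<\infty$) for all $\Lambda\in X^*$, $x\in X$. For $f\in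 L^1(\mu)$ and $x\in X$, $\int f\,d\mu(x)$ is the map $X^*\to\mathbb{C}$, $\Lambda\mapsto\int_\Omega f\,d\mu_{\Lambda,x}$; it is an element of $X^{**}$. The weak-$*$ topology of $X^{**}$ is the topology of pointwise convergence on $X^*$. *)

theory Defs
  imports "HOL-Analysis.Analysis"
begin

text \<open>
  The library has only real Banach spaces. A complex one is a real one with a multiplication by
  complex scalars that extends the real one and for which the norm is absolutely homogeneous.
\<close>

class scaleC =
  fixes scaleC :: "complex \<Rightarrow> 'a \<Rightarrow> 'a" (infixr \<open>*\<^sub>C\<close> 75)

class complex_banach = banach + scaleC +
  assumes scaleC_add_right: "c *\<^sub>C (x + y) = c *\<^sub>C x + c *\<^sub>C y"
    and scaleC_add_left: "(c + d) *\<^sub>C x = c *\<^sub>C x + d *\<^sub>C x"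
    and scaleC_scaleC: "c *\<^sub>C d *\<^sub>C x = (c * d) *\<^sub>C x"
    and scaleC_of_real: "complex_of_real r *\<^sub>C x = r *\<^sub>R x"
    and norm_scaleC: "norm (c *\<^sub>C x) = cmod c * norm x"

instantiation complex :: complex_banach
begin

definition scaleC_complex :: "complex \<Rightarrow> complex \<Rightarrow> complex" where
  "scaleC_complex c x = c * x"

instance
  by standard (auto simp: scaleC_complex_def algebra_simps scaleR_conv_of_real norm_mult)

end


section \<open>Dual and bidual\<close>

text \<open>
  The dual \<open>X\<^sup>*\<close> is the set of complex linear functionals inside the type of bounded real linear
  maps from \<open>X\<close> to the complex numbers, whose norm is the operator norm.
\<close>

definition cdual :: "('a::complex_banach \<Rightarrow>\<^sub>L complex) set" where
  "cdual = {\<Lambda>. \<forall>c x. blinfun_apply \<Lambda> (c *\<^sub>C x) = c * blinfun_apply \<Lambda> x}"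

definition cdual_scale :: "complex \<Rightarrow> ('a::complex_banach \<Rightarrow>\<^sub>L complex) \<Rightarrow> ('a \<Rightarrow>\<^sub>L complex)" where
  "cdual_scale c \<Lambda> = blinfun_mult_right c o\<^sub>L \<Lambda>"

lemma cdual_scale_apply: "blinfun_apply (cdual_scale c \<Lambda>) x = c * blinfun_apply \<Lambda> x"
  by (simp add: cdual_scale_def)

text \<open>Elements of \<open>X\<^sup>*\<^sup>*\<close> are functions on \<^const>\<open>cdual\<close>, hence the extensionality.\<close>

definition cbidual :: "(('a::complex_banach \<Rightarrow>\<^sub>L complex) \<Rightarrow> complex) set" where
  "cbidual = {\<phi> \<in> extensional cdual.
     (\<forall>\<Lambda>\<in>cdual. \<forall>\<Lambda>'\<in>cdual. \<phi> (\<Lambda> + \<Lambda>') = \<phi> \<Lambda> + \<phi> \<Lambda>') \<and>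
     (\<forall>c. \<forall>\<Lambda>\<in>cdual. \<phi> (cdual_scale c \<Lambda>) = c * \<phi> \<Lambda>) \<and>
     (\<exists>K. \<forall>\<Lambda>\<in>cdual. cmod (\<phi> \<Lambda>) \<le> K * norm \<Lambda>)}"

definition weak_star_topology ::
    "(('a::complex_banach \<Rightarrow>\<^sub>L complex) \<Rightarrow> complex) topology" where
  "weak_star_topology = subtopology (product_topology (\<lambda>_. euclidean) cdual) cbidual"


section \<open>Complex measures\<close>

text \<open>
  A measurable space \<open>(\<Omega>, \<Sigma>)\<close> is given by \<open>(space M, sets M)\<close>; the measure carried by \<open>M\<close> is
  irrelevant. A complex measure is only looked at on \<open>sets M\<close>; its values elsewhere are arbitrary.
\<close>

definition complex_measure :: "'w measure \<Rightarrow> ('w set \<Rightarrow> complex) \<Rightarrow> bool" where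
  "complex_measure M \<nu> \<longleftrightarrow>
     (\<forall>A :: nat \<Rightarrow> 'w set. range A \<subseteq> sets M \<and> disjoint_family A \<longrightarrow>
        (\<lambda>n. \<nu> (A n)) sums \<nu> (\<Union>n. A n))"

definition setwise_tendsto ::
    "'w measure \<Rightarrow> ('i \<Rightarrow> 'w set \<Rightarrow> complex) \<Rightarrow> ('w set \<Rightarrow> complex) \<Rightarrow> 'i filter \<Rightarrow> bool" where
  "setwise_tendsto M \<nu>s \<nu> F \<longleftrightarrow> (\<forall>E\<in>sets M. ((\<lambda>i. \<nu>s i E) \<longlongrightarrow> \<nu> E) F)"

text \<open>The values of \<open>|\<nu>|\<close>: supremum over countable measurable partitions.\<close>

definition variation_value :: "'w measure \<Rightarrow> ('w set \<Rightarrow> complex) \<Rightarrow> 'w set \<Rightarrow> ennreal" where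
  "variation_value M \<nu> E =
     (SUP A \<in> {A :: nat \<Rightarrow> 'w set. range A \<subseteq> sets M \<and> disjoint_family A \<and> (\<Union>n. A n) = E}.
        \<Sum>n. ennreal (cmod (\<nu> (A n))))"

definition total_variation :: "'w measure \<Rightarrow> ('w set \<Rightarrow> complex) \<Rightarrow> 'w measure" where
  "total_variation M \<nu> = measure_of (space M) (sets M) (variation_value M \<nu>)"

text \<open>
  \<^const>\<open>measure_of\<close> returns the zero measure on a set function that is not a measure; the lemma
  \<open>emeasure_total_variation\<close> shows that this does not happen here.
\<close>

lemma complex_measure_empty:
  assumes "complex_measure M \<nu>" shows "\<nu> {} = 0"
proof -
  have "(\<lambda>n::nat. \<nu> ((\<lambda>_. {}) n)) sums \<nu> (\<Union>n::nat. (\<lambda>_. {}) n)"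
    using assms unfolding complex_measure_def
    by (elim allE[of _ "\<lambda>_. {}"]) (auto simp: disjoint_family_on_def)
  then have "(\<lambda>n::nat. \<nu> {}) \<longlonglongrightarrow> 0"
    by (intro summable_LIMSEQ_zero) (auto simp: summable_def)
  then show ?thesis
    by (simp add: LIMSEQ_const_iff)
qed

lemma norm_le_suminf_ennreal:
  fixes a :: "nat \<Rightarrow> complex"
  assumes "a sums s" shows "ennreal (cmod s) \<le> (\<Sum>n. ennreal (cmod (a n)))"
proof -
  have "(\<lambda>n. ennreal (cmod (\<Sum>i<n. a i))) \<longlonglongrightarrow> ennreal (cmod s)"
    using assms unfolding sums_def by (intro tendsto_ennrealI tendsto_norm)
  then show ?thesis
  proof (rule LIMSEQ_le_const2, intro exI allI impI)
    fix n :: nat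
    have "ennreal (cmod (\<Sum>i<n. a i)) \<le> ennreal (\<Sum>i<n. cmod (a i))"
      by (intro ennreal_leI norm_sum)
    also have "\<dots> = (\<Sum>i<n. ennreal (cmod (a i)))" by (simp add: sum_ennreal)
    also have "\<dots> \<le> (\<Sum>n. ennreal (cmod (a n)))" by (intro sum_le_suminf) auto
    finally show "ennreal (cmod (\<Sum>i<n. a i)) \<le> (\<Sum>n. ennreal (cmod (a n)))" .
  qed
qed

lemma variation_value_le_suminf:
  assumes \<nu>: "complex_measure M \<nu>" and E: "range E \<subseteq> sets M" "disjoint_family E"
  shows "variation_value M \<nu> (\<Union>i. E i) \<le> (\<Sum>i. variation_value M \<nu> (E i))"
  unfolding variation_value_def
proof (rule SUP_least)
  fix A :: "nat \<Rightarrow> 'a set" 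
  assume "A \<in> {A. range A \<subseteq> sets M \<and> disjoint_family A \<and> (\<Union>n. A n) = (\<Union>i. E i)}"
  then have A: "range A \<subseteq> sets M" "disjoint_family A" "(\<Union>n. A n) = (\<Union>i. E i)" by auto
  have sm: "(\<lambda>i. \<nu> (A n \<inter> E i)) sums \<nu> (A n)" for n
  proof -
    have "range (\<lambda>i. A n \<inter> E i) \<subseteq> sets M" "disjoint_family (\<lambda>i. A n \<inter> E i)"
      using E A(1) by (blast, auto simp: disjoint_family_on_def)
    then have "(\<lambda>i. \<nu> (A n \<inter> E i)) sums \<nu> (\<Union>i. A n \<inter> E i)"
      using \<nu> unfolding complex_measure_def by blast
    also have "(\<Union>i. A n \<inter> E i) = A n" using A(3) by blast
    finally show ?thesis .
  qed
  have "(\<Sum>n. ennreal (cmod (\<nu> (A n)))) \<le> (\<Sum>n. \<Sum>i. ennreal (cmod (\<nu> (A n \<inter> E i))))"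
    by (intro suminf_le norm_le_suminf_ennreal sm) auto
  also have "\<dots> = (\<Sum>i. \<Sum>n. ennreal (cmod (\<nu> (A n \<inter> E i))))"
    unfolding nn_integral_count_space_nat[symmetric, of "\<lambda>n. \<Sum>i. ennreal (cmod (\<nu> (A n \<inter> E i)))"]
    by (subst nn_integral_suminf) (simp_all add: nn_integral_count_space_nat)
  also have "\<dots> \<le> (\<Sum>i. SUP A\<in>{A. range A \<subseteq> sets M \<and> disjoint_family A \<and> \<Union> (range A) = E i}.
        \<Sum>n. ennreal (cmod (\<nu> (A n))))"
  proof (intro suminf_le SUP_upper2[of "\<lambda>n. A n \<inter> E i" for i])
    fix i
    have "(\<Union>n. A n \<inter> E i) = E i" using A(3) by blast
    moreover have "disjoint_family (\<lambda>n. A n \<inter> E i)"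
      using A(2) unfolding disjoint_family_on_def by blast
    moreover have "range (\<lambda>n. A n \<inter> E i) \<subseteq> sets M"
      using A(1) E(1) by blast
    ultimately show "(\<lambda>n. A n \<inter> E i) \<in> {A. range A \<subseteq> sets M \<and> disjoint_family A \<and> \<Union> (range A) = E i}"
      by blast
  qed auto
  finally show "(\<Sum>n. ennreal (cmod (\<nu> (A n)))) \<le> (\<Sum>i. SUP A\<in>{A. range A \<subseteq> sets M \<and> disjoint_family A \<and> \<Union> (range A) = E i}.
        \<Sum>n. ennreal (cmod (\<nu> (A n))))" .
qed

lemma suminf_variation_value_le:
  assumes \<nu>: "complex_measure M \<nu>" and E: "range E \<subseteq> sets M" "disjoint_family E"
  shows "(\<Sum>i. variation_value M \<nu> (E i)) \<le> variation_value M \<nu> (\<Union>i. E i)"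
proof -
  define P where "P i = {A :: nat \<Rightarrow> 'a set. range A \<subseteq> sets M \<and> disjoint_family A \<and> (\<Union>n. A n) = E i}" for i
  define s where "s A = (\<Sum>n. ennreal (cmod (\<nu> (A n))))" for A :: "nat \<Rightarrow> 'a set"
  have V: "variation_value M \<nu> (E i) = (SUP A\<in>P i. s A)" for i
    by (simp add: variation_value_def P_def s_def)
  have ne: "P i \<noteq> {}" for i
  proof -
    have "(\<lambda>n. if n = 0 then E i else {}) \<in> P i"
      using E by (auto simp: P_def disjoint_family_on_def)
    then show ?thesis by blast
  qed
  have glue: "(\<Sum>i. s (B i)) \<le> variation_value M \<nu> (\<Union>i. E i)" if B: "\<And>i. B i \<in> P i" for B
  proof -
    define C where "C k = (case prod_decode k of (i, n) \<Rightarrow> B i n)" for k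
    have Bm: "B i n \<in> sets M" and Bu: "(\<Union>n. B i n) = E i" and Bd: "disjoint_family (B i)" for i n
      using B[of i] by (auto simp: P_def)
    have "disjoint_family C"
      unfolding disjoint_family_on_def
    proof (intro ballI impI)
      fix k l :: nat assume "k \<noteq> l"
      obtain i n j m where kl: "prod_decode k = (i, n)" "prod_decode l = (j, m)" by fastforce
      then have "(i, n) \<noteq> (j, m)" using \<open>k \<noteq> l\<close> by (metis prod_decode_inverse)
      moreover have "B i n \<inter> B j m = {}" if "i \<noteq> j"
        using that Bu E(2) unfolding disjoint_family_on_def by blast
      moreover have "B i n \<inter> B i m = {}" if "n \<noteq> m"
        using that Bd[of i] unfolding disjoint_family_on_def by blast
      ultimately show "C k \<inter> C l = {}" by (auto simp: C_def kl)
    qed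
    moreover have "range C \<subseteq> sets M" using Bm by (auto simp: C_def split: prod.split)
    moreover have "(\<Union>k. C k) = (\<Union>i. E i)"
    proof -
      have "B i n \<subseteq> (\<Union>k. C k)" for i n
        using UN_upper[of "prod_encode (i, n)" UNIV C] by (simp add: C_def)
      then have "(\<Union>i. E i) \<subseteq> (\<Union>k. C k)" unfolding Bu[symmetric] by blast
      moreover have "C k \<subseteq> (\<Union>i. E i)" for k
      proof -
        obtain i n where k: "prod_decode k = (i, n)" by fastforce
        have "B i n \<subseteq> E i" using Bu[of i] by blast
        then show ?thesis by (auto simp: C_def k)
      qed
      ultimately show ?thesis by blast
    qed
    moreover have "(\<Sum>k. ennreal (cmod (\<nu> (C k)))) = (\<Sum>i. s (B i))"
    proof -
      have "(\<Sum>k. case_prod (\<lambda>i n. ennreal (cmod (\<nu> (B i n)))) (prod_decode k)) = (\<Sum>i. s (B i))"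
        by (rule suminf_ennreal_2dimen) (simp add: s_def)
      moreover have "ennreal (cmod (\<nu> (C k)))
          = case_prod (\<lambda>i n. ennreal (cmod (\<nu> (B i n)))) (prod_decode k)" for k
        by (simp add: C_def split: prod.split)
      ultimately show ?thesis by presburger
    qed
    ultimately show ?thesis
      unfolding variation_value_def by (intro SUP_upper2[of C]) auto
  qed
  have part: "(\<Sum>i<k. variation_value M \<nu> (E i)) + (\<Sum>i. s (B (i + k))) \<le> variation_value M \<nu> (\<Union>i. E i)"
    if "\<And>i. B i \<in> P i" for k B
    using that
  proof (induction k arbitrary: B)
    case 0
    then show ?case using glue by simp
  next
    case (Suc k)
    have "(\<Sum>i<Suc k. variation_value M \<nu> (E i)) + (\<Sum>i. s (B (i + Suc k)))
        = (SUP A\<in>P k. s A) + ((\<Sum>i<k. variation_value M \<nu> (E i)) + (\<Sum>i. s (B (i + Suc k))))"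
      by (simp add: V ac_simps)
    also have "\<dots> = (SUP A\<in>P k. s A + ((\<Sum>i<k. variation_value M \<nu> (E i)) + (\<Sum>i. s (B (i + Suc k)))))"
      by (rule ennreal_SUP_add_left[OF ne, symmetric])
    also have "\<dots> \<le> variation_value M \<nu> (\<Union>i. E i)"
    proof (rule SUP_least)
      fix A assume "A \<in> P k"
      then have "(\<Sum>i<k. variation_value M \<nu> (E i)) + (\<Sum>i. s ((B(k := A)) (i + k)))
          \<le> variation_value M \<nu> (\<Union>i. E i)"
        using Suc.prems by (intro Suc.IH) auto
      moreover have "(\<Sum>i. s ((B(k := A)) (i + k))) = s A + (\<Sum>i. s (B (i + Suc k)))"
        by (subst suminf_offset[of _ 1]) auto
      ultimately show "s A + ((\<Sum>i<k. variation_value M \<nu> (E i)) + (\<Sum>i. s (B (i + Suc k))))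
          \<le> variation_value M \<nu> (\<Union>i. E i)"
        by (simp add: ac_simps)
    qed
    finally show ?case .
  qed
  define B where "B i = (SOME A. A \<in> P i)" for i
  have B: "B i \<in> P i" for i
    unfolding B_def using ne[of i] by (simp add: some_in_eq)
  have "(\<Sum>i<k. variation_value M \<nu> (E i)) \<le> variation_value M \<nu> (\<Union>i. E i)" for k
    by (rule order_trans[OF _ part[OF B, of k]]) simp
  then show ?thesis
    by (rule suminf_le_const[OF summableI])
qed

lemma emeasure_total_variation:
  assumes \<nu>: "complex_measure M \<nu>" and E: "E \<in> sets M"
  shows "emeasure (total_variation M \<nu>) E = variation_value M \<nu> E"
proof -
  have "variation_value M \<nu> {} \<le> 0"
    unfolding variation_value_def
  proof (rule SUP_least)
    fix A :: "nat \<Rightarrow> 'a set"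
    assume "A \<in> {A. range A \<subseteq> sets M \<and> disjoint_family A \<and> (\<Union>n. A n) = {}}"
    then have "A n = {}" for n by blast
    then show "(\<Sum>n. ennreal (cmod (\<nu> (A n)))) \<le> 0"
      by (simp add: complex_measure_empty[OF \<nu>])
  qed
  then have pos: "positive (sets M) (variation_value M \<nu>)"
    by (simp add: positive_def)
  have "countably_additive (sets M) (variation_value M \<nu>)"
    unfolding countably_additive_def
    using variation_value_le_suminf[OF \<nu>] suminf_variation_value_le[OF \<nu>] by (blast intro: antisym)
  with pos show ?thesis
    unfolding total_variation_def
    by (intro emeasure_measure_of_sigma[OF sets.sigma_algebra_axioms _ _ E])
qed

text \<open>
  Jordan decomposition of a real measure \<open>\<rho>\<close>: its positive part is \<open>(|\<rho>| + \<rho>) / 2\<close> and its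
  negative part, \<open>(|\<rho>| - \<rho>) / 2\<close>, is the positive part of \<open>-\<rho>\<close>.
\<close>

definition positive_part :: "'w measure \<Rightarrow> ('w set \<Rightarrow> real) \<Rightarrow> 'w measure" where
  "positive_part M \<rho> = measure_of (space M) (sets M)
     (\<lambda>E. ennreal ((measure (total_variation M (\<lambda>E. complex_of_real (\<rho> E))) E + \<rho> E) / 2))"

definition complex_measure_integral ::
    "'w measure \<Rightarrow> ('w set \<Rightarrow> complex) \<Rightarrow> ('w \<Rightarrow> complex) \<Rightarrow> complex" where
  "complex_measure_integral M \<nu> f =
     ((LINT w|positive_part M (\<lambda>E. Re (\<nu> E)). f w)
       - (LINT w|positive_part M (\<lambda>E. - Re (\<nu> E)). f w))
     + \<i> * ((LINT w|positive_part M (\<lambda>E. Im (\<nu> E)). f w)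
       - (LINT w|positive_part M (\<lambda>E. - Im (\<nu> E)). f w))"


section \<open>Operator projection families\<close>

text \<open>
  Norm convergent nets are rendered by filters: a net in \<open>X\<^sup>*\<close> (in \<open>X\<close>) matters only through the
  filter of its tails, so the continuity conditions quantify over all filters on \<open>X\<^sup>*\<close> (on \<open>X\<close>).
  The lemmas \<open>operator_projection_family_net_dual\<close> and \<open>operator_projection_family_net_space\<close>
  below give them for nets with any index type.
\<close>

definition operator_projection_family ::
    "'w measure \<Rightarrow> (('a::complex_banach \<Rightarrow>\<^sub>L complex) \<Rightarrow> 'a \<Rightarrow> 'w set \<Rightarrow> complex) \<Rightarrow> bool" where
  "operator_projection_family M \<mu> \<longleftrightarrow>
     (\<forall>\<Lambda>\<in>cdual. \<forall>x. complex_measure M (\<mu> \<Lambda> x)) \<and>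
     (\<forall>\<Lambda>\<in>cdual. \<forall>\<Lambda>'\<in>cdual. \<forall>x. \<forall>E\<in>sets M. \<mu> (\<Lambda> + \<Lambda>') x E = \<mu> \<Lambda> x E + \<mu> \<Lambda>' x E) \<and>
     (\<forall>c. \<forall>\<Lambda>\<in>cdual. \<forall>x. \<forall>E\<in>sets M. \<mu> (cdual_scale c \<Lambda>) x E = c * \<mu> \<Lambda> x E) \<and>
     (\<forall>\<Lambda>\<in>cdual. \<forall>x y. \<forall>E\<in>sets M. \<mu> \<Lambda> (x + y) E = \<mu> \<Lambda> x E + \<mu> \<Lambda> y E) \<and>
     (\<forall>c. \<forall>\<Lambda>\<in>cdual. \<forall>x. \<forall>E\<in>sets M. \<mu> \<Lambda> (c *\<^sub>C x) E = c * \<mu> \<Lambda> x E) \<and>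
     (\<forall>\<Lambda>\<in>cdual. \<forall>x. \<forall>F. (\<forall>\<^sub>F \<Lambda>' in F. \<Lambda>' \<in> cdual) \<and> ((\<lambda>\<Lambda>'. \<Lambda>') \<longlongrightarrow> \<Lambda>) F \<longrightarrow>
        setwise_tendsto M (\<lambda>\<Lambda>'. \<mu> \<Lambda>' x) (\<mu> \<Lambda> x) F) \<and>
     (\<forall>\<Lambda>\<in>cdual. \<forall>x. \<forall>F. ((\<lambda>y. y) \<longlongrightarrow> x) F \<longrightarrow> setwise_tendsto M (\<lambda>y. \<mu> \<Lambda> y) (\<mu> \<Lambda> x) F)"

lemma operator_projection_family_net_dual:
  assumes "operator_projection_family M \<mu>" and "\<forall>\<^sub>F i in G. L i \<in> cdual"
    and "\<Lambda> \<in> cdual" and "(L \<longlongrightarrow> \<Lambda>) G"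
  shows "setwise_tendsto M (\<lambda>i. \<mu> (L i) x) (\<mu> \<Lambda> x) G"
proof -
  have "\<forall>\<^sub>F \<Lambda>' in filtermap L G. \<Lambda>' \<in> cdual" "((\<lambda>\<Lambda>'. \<Lambda>') \<longlongrightarrow> \<Lambda>) (filtermap L G)"
    using assms(2,4) by (simp_all add: eventually_filtermap filterlim_filtermap)
  then have "setwise_tendsto M (\<lambda>\<Lambda>'. \<mu> \<Lambda>' x) (\<mu> \<Lambda> x) (filtermap L G)"
    using assms(1,3) unfolding operator_projection_family_def by blast
  then show ?thesis
    by (simp add: setwise_tendsto_def filterlim_filtermap)
qed

lemma operator_projection_family_net_space:
  assumes "operator_projection_family M \<mu>" and "\<Lambda> \<in> cdual" and "(y \<longlongrightarrow> x) G"
  shows "setwise_tendsto M (\<lambda>i. \<mu> \<Lambda> (y i)) (\<mu> \<Lambda> x) G"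
proof -
  have "((\<lambda>z. z) \<longlongrightarrow> x) (filtermap y G)"
    using assms(3) by (simp add: filterlim_filtermap)
  then have "setwise_tendsto M (\<lambda>z. \<mu> \<Lambda> z) (\<mu> \<Lambda> x) (filtermap y G)"
    using assms(1,2) unfolding operator_projection_family_def by blast
  then show ?thesis
    by (simp add: setwise_tendsto_def filterlim_filtermap)
qed

definition L1_family ::
    "'w measure \<Rightarrow> (('a::complex_banach \<Rightarrow>\<^sub>L complex) \<Rightarrow> 'a \<Rightarrow> 'w set \<Rightarrow> complex)
      \<Rightarrow> ('w \<Rightarrow> complex) set" where
  "L1_family M \<mu> = {f \<in> borel_measurable M.
     \<forall>\<Lambda>\<in>cdual. \<forall>x. (\<integral>\<^sup>+ w. ennreal (cmod (f w)) \<partial>total_variation M (\<mu> \<Lambda> x)) < \<infinity>}"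

definition family_integral ::
    "'w measure \<Rightarrow> (('a::complex_banach \<Rightarrow>\<^sub>L complex) \<Rightarrow> 'a \<Rightarrow> 'w set \<Rightarrow> complex)
      \<Rightarrow> ('w \<Rightarrow> complex) \<Rightarrow> 'a \<Rightarrow> ('a \<Rightarrow>\<^sub>L complex) \<Rightarrow> complex" where
  "family_integral M \<mu> f x = (\<lambda>\<Lambda>\<in>cdual. complex_measure_integral M (\<mu> \<Lambda> x) f)"

end

theory Submission
  imports Defs
begin

text \<open>
  Real and imaginary part of a complex measure have finite total variation, hence Jordan
  decompositions into finite measures dominated by the total variation; this reduces the convergence
  of the integrals to the dominated convergence theorem for positive measures. That the limit lies
  in the bidual is seen by approximating \<open>f\<close> by simple functions \<open>s\<^sub>i\<close>:
  the maps \<open>\<Lambda> \<mapsto> \<integral> s\<^sub>i d\<mu>\<^sub>\<Lambda>\<^sub>,\<^sub>x\<close> are continuous linear functionals on the Banach space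
  \<open>X\<^sup>*\<close> and converge pointwise, so by the uniform boundedness principle the limit is a bounded
  functional.
\<close>

section \<open>Finite additivity and elementary bounds on the variation\<close>

text \<open>Padding the finite family with empty sets reduces the claim to countable additivity; the
  padding contributes nothing because \<open>\<nu> {} = 0\<close>.\<close>

lemma complex_measure_finite_Union:
  assumes \<nu>: "complex_measure M \<nu>" and K: "finite K"
    and C: "\<And>i. i \<in> K \<Longrightarrow> C i \<in> sets M" "disjoint_family_on C K"
  shows "\<nu> (\<Union>i\<in>K. C i) = (\<Sum>i\<in>(K::nat set). \<nu> (C i))"
proof -
  define D where "D i = (if i \<in> K then C i else {})" for i
  have "range D \<subseteq> sets M" "disjoint_family D"
    using C by (auto simp: D_def disjoint_family_on_def)
  then have "(\<lambda>i. \<nu> (D i)) sums \<nu> (\<Union>i. D i)"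
    using \<nu> unfolding complex_measure_def by blast
  moreover have "(\<Union>i. D i) = (\<Union>i\<in>K. C i)"
    by (auto simp: D_def split: if_splits)
  moreover have "(\<lambda>i. \<nu> (D i)) = (\<lambda>i. if i \<in> K then \<nu> (C i) else 0)"
    using complex_measure_empty[OF \<nu>] by (auto simp: D_def)
  ultimately have "(\<lambda>i. if i \<in> K then \<nu> (C i) else 0) sums \<nu> (\<Union>i\<in>K. C i)"
    by simp
  then show ?thesis
    using sums_If_finite_set[OF K, of "\<lambda>i. \<nu> (C i)"] sums_unique2 by blast
qed

lemma complex_measure_Un:
  assumes \<nu>: "complex_measure M \<nu>" and "A \<in> sets M" "B \<in> sets M" "A \<inter> B = {}"
  shows "\<nu> (A \<union> B) = \<nu> A + \<nu> B"
proof -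
  define C where "C i = (if i = (0::nat) then A else B)" for i
  have "disjoint_family_on C {0, 1}" "\<And>i. C i \<in> sets M"
    using assms by (auto simp: C_def disjoint_family_on_def)
  then have "\<nu> (\<Union>i\<in>{0, 1}. C i) = (\<Sum>i\<in>{0, 1}. \<nu> (C i))"
    by (intro complex_measure_finite_Union[OF \<nu>]) auto
  then show ?thesis by (simp add: C_def Un_commute)
qed

text \<open>The set itself followed by empty sets is one of the partitions in the supremum.\<close>

lemma cmod_le_variation_value:
  assumes "E \<in> sets M" "complex_measure M \<nu>"
  shows "ennreal (cmod (\<nu> E)) \<le> variation_value M \<nu> E"
proof -
  define A where "A n = (if n = (0::nat) then E else {})" for n
  have "ennreal (cmod (\<nu> (A n))) = (if n = 0 then ennreal (cmod (\<nu> E)) else 0)" for n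
    using complex_measure_empty[OF assms(2)] by (simp add: A_def)
  then have "(\<Sum>n. ennreal (cmod (\<nu> (A n)))) = ennreal (cmod (\<nu> E))"
    using suminf_finite[of "{0}" "\<lambda>n. ennreal (cmod (\<nu> (A n)))"] by simp
  moreover have "range A \<subseteq> sets M" "disjoint_family A" "(\<Union>n. A n) = E"
    using assms(1) by (auto simp: A_def disjoint_family_on_def split: if_splits)
  ultimately show ?thesis
    unfolding variation_value_def by (intro SUP_upper2[of A]) auto
qed

lemma variation_value_mono:
  assumes "\<And>E. E \<in> sets M \<Longrightarrow> cmod (\<nu> E) \<le> cmod (\<nu>' E)"
  shows "variation_value M \<nu> E \<le> variation_value M \<nu>' E"
  unfolding variation_value_def
  by (rule SUP_subset_mono[OF order.refl]) (auto intro!: suminf_le ennreal_leI assms)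

lemma sets_total_variation [simp]: "sets (total_variation M \<nu>) = sets M"
  by (simp add: total_variation_def)

section \<open>Finiteness of the variation of a real measure\<close>

text \<open>In a partition with a large sum of absolute values, the terms of one sign already have a
  large sum, so the union \<open>A\<close> of their sets has large
  \<open>\<bar>\<rho> A\<bar>\<close>. As \<open>\<rho> E\<close> is a fixed real number,
  \<open>\<bar>\<rho> (E - A)\<bar>\<close> is large too. One of the two pieces inherits the
  infinite variation and serves as \<open>B\<close>.\<close>

lemma infinite_variation_split:
  fixes \<rho> :: "'w set \<Rightarrow> real"
  defines "\<nu> \<equiv> \<lambda>E. complex_of_real (\<rho> E)"
  assumes \<nu>: "complex_measure M \<nu>" and E: "E \<in> sets M" and inf: "variation_value M \<nu> E = \<infinity>"
  shows "\<exists>B\<in>sets M. B \<subseteq> E \<and> variation_value M \<nu> B = \<infinity> \<and> 1 \<le> \<bar>\<rho> (E - B)\<bar>"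
proof -
  \<comment> \<open>The factor 2 put before \<open>t\<close> pays for separating the terms by sign;
    the summand \<open>\<bar>\<rho> E\<bar>\<close> pays for passing from \<open>A\<close> to its
    complement in \<open>E\<close>, which leaves the required 1.\<close>
  define t where "t = 1 + \<bar>\<rho> E\<bar>"
  have "ennreal (2 * t) < variation_value M \<nu> E" using inf by simp
  then obtain C where C: "range C \<subseteq> sets M" "disjoint_family C" "(\<Union>n::nat. C n) = E"
    and "ennreal (2 * t) < (\<Sum>n. ennreal (cmod (\<nu> (C n))))"
    unfolding variation_value_def less_SUP_iff by auto
  then obtain n where "ennreal (2 * t) < (\<Sum>i<n. ennreal (cmod (\<nu> (C i))))"
    unfolding suminf_eq_SUP less_SUP_iff by blast
  then have "ennreal (2 * t) < ennreal (\<Sum>i<n. \<bar>\<rho> (C i)\<bar>)"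
    by (simp add: sum_ennreal \<nu>_def)
  then have big: "2 * t < (\<Sum>i<n. \<bar>\<rho> (C i)\<bar>)"
    by (subst (asm) ennreal_less_iff) (simp_all add: t_def)
  define I where "I = {i. i < n \<and> 0 \<le> \<rho> (C i)}"
  define J where "J = {i. i < n \<and> \<rho> (C i) < 0}"
  have IJ: "finite I" "finite J" "I \<inter> J = {}" "{..<n} = I \<union> J" by (auto simp: I_def J_def)
  have "(\<Sum>i<n. \<bar>\<rho> (C i)\<bar>) = (\<Sum>i\<in>I. \<bar>\<rho> (C i)\<bar>) + (\<Sum>i\<in>J. \<bar>\<rho> (C i)\<bar>)"
    unfolding IJ(4) using IJ by (intro sum.union_disjoint) auto
  also have "(\<Sum>i\<in>I. \<bar>\<rho> (C i)\<bar>) = (\<Sum>i\<in>I. \<rho> (C i))"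
    by (intro sum.cong) (auto simp: I_def)
  also have "(\<Sum>i\<in>J. \<bar>\<rho> (C i)\<bar>) = - (\<Sum>i\<in>J. \<rho> (C i))"
    unfolding sum_negf[symmetric] by (intro sum.cong) (auto simp: J_def)
  finally have "t < \<bar>\<Sum>i\<in>I. \<rho> (C i)\<bar> \<or> t < \<bar>\<Sum>i\<in>J. \<rho> (C i)\<bar>"
    using big by linarith
  then obtain K where K: "finite K" "t < \<bar>\<Sum>i\<in>K. \<rho> (C i)\<bar>" using IJ by blast
  define A where "A = (\<Union>i\<in>K. C i)"
  have Am: "A \<in> sets M" using C(1) K(1) unfolding A_def by blast
  have AE: "A \<subseteq> E" using C(3) by (auto simp: A_def)
  have "\<nu> A = (\<Sum>i\<in>K. \<nu> (C i))"
    unfolding A_def using C K(1)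
    by (intro complex_measure_finite_Union[OF \<nu>]) (auto simp: disjoint_family_on_def)
  then have "complex_of_real (\<rho> A) = complex_of_real (\<Sum>i\<in>K. \<rho> (C i))"
    by (simp add: \<nu>_def)
  then have "\<rho> A = (\<Sum>i\<in>K. \<rho> (C i))"
    by (simp only: of_real_eq_iff)
  with K have A: "t < \<bar>\<rho> A\<bar>" by simp
  have EA: "E - A \<in> sets M" "A \<union> (E - A) = E" using E Am AE by auto
  have "\<nu> (A \<union> (E - A)) = \<nu> A + \<nu> (E - A)"
    using complex_measure_Un[OF \<nu> Am EA(1)] by blast
  then have "complex_of_real (\<rho> E) = complex_of_real (\<rho> A + \<rho> (E - A))"
    by (simp only: EA(2) \<nu>_def of_real_add)
  then have "\<rho> E = \<rho> A + \<rho> (E - A)"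
    by (simp only: of_real_eq_iff)
  with A have B: "1 < \<bar>\<rho> (E - A)\<bar>" unfolding t_def by linarith
  \<comment> \<open>Additivity of the variation is read off from \<open>total_variation\<close>
    being a measure.\<close>
  have "variation_value M \<nu> A + variation_value M \<nu> (E - A) = variation_value M \<nu> E"
    using plus_emeasure[of A "total_variation M \<nu>" "E - A"] Am EA E
    by (simp add: emeasure_total_variation[OF \<nu>])
  then consider "variation_value M \<nu> A = \<infinity>" | "variation_value M \<nu> (E - A) = \<infinity>"
    using inf by (auto simp: ennreal_add_eq_top)
  then show ?thesis
  proof cases
    case 1
    then show ?thesis using Am AE B by (intro bexI[of _ A]) auto
  next
    case 2
    have "E - (E - A) = A" using AE by blast
    then show ?thesis using 2 EA A by (intro bexI[of _ "E - A"]) (auto simp: t_def)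
  qed
qed

text \<open>
  A set of infinite variation could be split forever into disjoint pieces of measure at least 1
  in absolute value, against the convergence of the series of these measures.
\<close>

lemma variation_value_real_finite:
  fixes \<rho> :: "'w set \<Rightarrow> real"
  defines "\<nu> \<equiv> \<lambda>E. complex_of_real (\<rho> E)"
  assumes \<nu>: "complex_measure M \<nu>" and E: "E \<in> sets M"
  shows "variation_value M \<nu> E < \<infinity>"
proof (rule ccontr)
  assume "\<not> ?thesis"
  then have inf: "variation_value M \<nu> E = \<infinity>" by (simp add: less_top[symmetric])
  define P where "P B \<longleftrightarrow> B \<in> sets M \<and> variation_value M \<nu> B = \<infinity>" for B
  define Q where "Q B B' \<longleftrightarrow> B' \<subseteq> B \<and> 1 \<le> \<bar>\<rho> (B - B')\<bar>" for B B'
  have "\<exists>S. \<forall>n::nat. P (S n) \<and> Q (S n) (S (Suc n))"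
  proof (rule dependent_nat_choice)
    show "\<exists>B. P B" using E inf by (auto simp: P_def)
    fix B and n :: nat assume "P B"
    then show "\<exists>B'. P B' \<and> Q B B'"
      using infinite_variation_split[of M \<rho> B] \<nu> by (auto simp: P_def Q_def \<nu>_def)
  qed
  then obtain S :: "nat \<Rightarrow> 'w set" where S: "\<And>n. P (S n)" "\<And>n. Q (S n) (S (Suc n))"
    by blast
  define A where "A n = S n - S (Suc n)" for n
  have "decseq S" using S(2) by (simp add: decseq_Suc_iff Q_def)
  \<comment> \<open>For \<open>m < n\<close> the set \<open>A n\<close> lies in \<open>S n\<close>,
    hence in \<open>S (Suc m)\<close>, which was removed from \<open>S m\<close> to form
    \<open>A m\<close>.\<close>
  then have "A m \<inter> A n = {}" if "m < n" for m n
    using decseqD[of S "Suc m" n] that by (auto simp: A_def)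
  then have "disjoint_family A"
    unfolding disjoint_family_on_def by (metis Int_commute nat_neq_iff)
  moreover have "range A \<subseteq> sets M" using S(1) by (auto simp: A_def P_def)
  ultimately have "(\<lambda>n. \<nu> (A n)) sums \<nu> (\<Union>n. A n)"
    using \<nu> unfolding complex_measure_def by blast
  then have "(\<lambda>n. \<nu> (A n)) \<longlonglongrightarrow> 0"
    using summable_LIMSEQ_zero sums_summable by blast
  then have "\<forall>\<^sub>F n in sequentially. cmod (\<nu> (A n)) < 1"
    using order_tendstoD(2)[OF tendsto_norm, of _ 0 sequentially 1] by simp
  then obtain n where "cmod (\<nu> (A n)) < 1"
    by (meson eventually_happens sequentially_bot trivial_limit_sequentially)
  moreover have "1 \<le> \<bar>\<rho> (A n)\<bar>" using S(2)[of n] by (simp add: A_def Q_def)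
  ultimately show False by (simp add: \<nu>_def)
qed

section \<open>The Jordan decomposition of a real measure\<close>

lemma sets_positive_part [simp, measurable_cong]: "sets (positive_part M \<rho>) = sets M"
  by (simp add: positive_part_def)

lemma space_positive_part [simp]: "space (positive_part M \<rho>) = space M"
  by (simp add: positive_part_def)

context
  fixes M :: "'w measure" and \<rho> :: "'w set \<Rightarrow> real" and \<nu> :: "'w set \<Rightarrow> complex"
  defines "\<nu> \<equiv> \<lambda>E. complex_of_real (\<rho> E)"
  assumes \<nu>: "complex_measure M \<nu>"
begin

lemma finite_measure_total_variation_real: "finite_measure (total_variation M \<nu>)"
proof (rule finite_measureI)
  have "emeasure (total_variation M \<nu>) (space M) < \<infinity>"
    using variation_value_real_finite[of M \<rho> "space M"] \<nu>
    by (simp add: emeasure_total_variation \<nu>_def)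
  then show "emeasure (total_variation M \<nu>) (space (total_variation M \<nu>)) \<noteq> \<infinity>"
    by (simp add: total_variation_def)
qed

lemma abs_le_measure_total_variation:
  assumes E: "E \<in> sets M"
  shows "\<bar>\<rho> E\<bar> \<le> measure (total_variation M \<nu>) E"
proof -
  interpret finite_measure "total_variation M \<nu>" by (rule finite_measure_total_variation_real)
  have "ennreal \<bar>\<rho> E\<bar> \<le> variation_value M \<nu> E"
    using cmod_le_variation_value[OF E \<nu>] by (simp add: \<nu>_def)
  also have "\<dots> = ennreal (measure (total_variation M \<nu>) E)"
    using E by (simp add: emeasure_total_variation[OF \<nu>, symmetric] emeasure_eq_measure)
  finally show ?thesis by simp
qed

text \<open>The defining set function has to be shown to be a measure before
  \<open>measure_of\<close> returns its values. Nonnegativity comes from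
  \<open>\<bar>\<rho> E\<bar>\<close> being at most the variation and keeps \<open>ennreal\<close>
  from truncating; countable additivity is a sum of two convergent real series, the variation being
  finite.\<close>

lemma emeasure_positive_part:
  assumes E: "E \<in> sets M"
  shows "emeasure (positive_part M \<rho>) E
    = ennreal ((measure (total_variation M \<nu>) E + \<rho> E) / 2)"
proof -
  interpret T: finite_measure "total_variation M \<nu>" by (rule finite_measure_total_variation_real)
  define m where "m E = (measure (total_variation M \<nu>) E + \<rho> E) / 2" for E
  have m0: "0 \<le> m A" if "A \<in> sets M" for A
    using abs_le_measure_total_variation[OF that] by (simp add: m_def)
  have "positive (sets M) (\<lambda>E. ennreal (m E))"
    using complex_measure_empty[OF \<nu>] by (simp add: positive_def m_def \<nu>_def)
  moreover have "countably_additive (sets M) (\<lambda>E. ennreal (m E))"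
    unfolding countably_additive_def
  proof (intro allI impI)
    fix A :: "nat \<Rightarrow> 'w set"
    assume A: "range A \<subseteq> sets M" "disjoint_family A" "\<Union> (range A) \<in> sets M"
    have "(\<lambda>n. \<nu> (A n)) sums \<nu> (\<Union>n. A n)"
      using \<nu> A unfolding complex_measure_def by blast
    then have "(\<lambda>n. \<rho> (A n)) sums \<rho> (\<Union>n. A n)"
      by (simp add: \<nu>_def sums_of_real_iff)
    moreover have "(\<lambda>n. measure (total_variation M \<nu>) (A n)) sums measure (total_variation M \<nu>) (\<Union>n. A n)"
      using A by (intro T.finite_measure_UNION) auto
    ultimately have "(\<lambda>n. m (A n)) sums m (\<Union>n. A n)"
      unfolding m_def by (intro sums_divide sums_add)
    moreover have "0 \<le> m (A n)" for n using A(1) by (intro m0) auto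
    ultimately show "(\<Sum>n. ennreal (m (A n))) = ennreal (m (\<Union> (range A)))"
      by (intro suminf_ennreal_eq)
  qed
  ultimately show ?thesis
    unfolding positive_part_def \<nu>_def[symmetric] m_def[symmetric]
    by (intro emeasure_measure_of_sigma[OF sets.sigma_algebra_axioms _ _ E])
qed

lemma finite_measure_positive_part: "finite_measure (positive_part M \<rho>)"
  by (rule finite_measureI) (simp add: emeasure_positive_part)

lemma positive_part_le_total_variation:
  assumes E: "E \<in> sets M"
  shows "emeasure (positive_part M \<rho>) E \<le> emeasure (total_variation M \<nu>) E"
proof -
  interpret T: finite_measure "total_variation M \<nu>" by (rule finite_measure_total_variation_real)
  show ?thesis
    using abs_le_measure_total_variation[OF E]
    by (simp add: emeasure_positive_part[OF E] T.emeasure_eq_measure ennreal_leI)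
qed

lemma measure_positive_part:
  assumes E: "E \<in> sets M"
  shows "measure (positive_part M \<rho>) E = (measure (total_variation M \<nu>) E + \<rho> E) / 2"
  using abs_le_measure_total_variation[OF E]
  by (simp add: measure_def[of "positive_part M \<rho>"] emeasure_positive_part[OF E])

end

lemma total_variation_uminus: "total_variation M (\<lambda>E. - \<nu> E) = total_variation M \<nu>"
  unfolding total_variation_def variation_value_def[abs_def] by simp

lemma complex_measure_uminus:
  "complex_measure M \<nu> \<Longrightarrow> complex_measure M (\<lambda>E. - \<nu> E)"
  by (auto simp: complex_measure_def intro!: sums_minus)

lemma complex_measure_Re:
  "complex_measure M \<nu> \<Longrightarrow> complex_measure M (\<lambda>E. complex_of_real (Re (\<nu> E)))"
  by (auto simp: complex_measure_def intro!: sums_of_real sums_Re)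

lemma complex_measure_Im:
  "complex_measure M \<nu> \<Longrightarrow> complex_measure M (\<lambda>E. complex_of_real (Im (\<nu> E)))"
  by (auto simp: complex_measure_def intro!: sums_of_real sums_Im)

text \<open>A change of sign does not affect the variation, so the variation cancels in the
  difference and two halves of \<open>\<rho> E\<close> remain.\<close>

lemma positive_part_diff:
  assumes "complex_measure M (\<lambda>E. complex_of_real (\<rho> E))" and "E \<in> sets M"
  shows "measure (positive_part M \<rho>) E - measure (positive_part M (\<lambda>E. - \<rho> E)) E = \<rho> E"
proof -
  have "complex_measure M (\<lambda>E. complex_of_real (- \<rho> E))"
    using complex_measure_uminus[OF assms(1)] by simp
  from measure_positive_part[OF this assms(2)] measure_positive_part[OF assms]
  show ?thesis
    by (simp add: total_variation_uminus field_simps)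
qed

text \<open>The bound on \<open>\<rho>\<close> is tailored to plus or minus the real or imaginary
  part of \<open>\<nu>\<close>. Thus integrability with respect to the total variation carries over
  to all four measures in \<open>complex_measure_integral\<close>.\<close>

lemma nn_integral_positive_part_le:
  assumes \<rho>: "complex_measure M (\<lambda>E. complex_of_real (\<rho> E))" and \<nu>: "complex_measure M \<nu>"
    and le: "\<And>E. E \<in> sets M \<Longrightarrow> \<bar>\<rho> E\<bar> \<le> cmod (\<nu> E)"
  shows "(\<integral>\<^sup>+w. f w \<partial>positive_part M \<rho>) \<le> (\<integral>\<^sup>+w. f w \<partial>total_variation M \<nu>)"
proof (rule nn_integral_mono_measure)
  have "emeasure (positive_part M \<rho>) E \<le> emeasure (total_variation M \<nu>) E" if E: "E \<in> sets M" for E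
  proof -
    have "emeasure (positive_part M \<rho>) E \<le> variation_value M (\<lambda>E. complex_of_real (\<rho> E)) E"
      using positive_part_le_total_variation[OF \<rho> E] by (simp add: emeasure_total_variation[OF \<rho> E])
    also have "\<dots> \<le> variation_value M \<nu> E"
      by (rule variation_value_mono) (simp add: le)
    finally show ?thesis by (simp add: emeasure_total_variation[OF \<nu> E])
  qed
  then show "positive_part M \<rho> \<le> total_variation M \<nu>"
    by (subst le_measure) auto
qed simp_all



lemma integrable_positive_part:
  fixes f :: "'w \<Rightarrow> complex"
  assumes \<rho>: "complex_measure M (\<lambda>E. complex_of_real (\<rho> E))" and \<nu>: "complex_measure M \<nu>"
    and le: "\<And>E. E \<in> sets M \<Longrightarrow> \<bar>\<rho> E\<bar> \<le> cmod (\<nu> E)"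
    and f: "f \<in> borel_measurable M" "(\<integral>\<^sup>+w. ennreal (cmod (f w)) \<partial>total_variation M \<nu>) < \<infinity>"
  shows "integrable (positive_part M \<rho>) f"
proof (rule integrableI_bounded)
  show "(\<integral>\<^sup>+w. ennreal (cmod (f w)) \<partial>positive_part M \<rho>) < \<infinity>"
    using nn_integral_positive_part_le[OF \<rho> \<nu> le] f(2) by (rule order_le_less_trans)
  show "f \<in> borel_measurable (positive_part M \<rho>)"
    using f(1) by (simp cong: measurable_cong_sets)
qed

section \<open>Integrals of simple functions\<close>

lemma integral_positive_part_simple:
  fixes s :: "'w \<Rightarrow> complex"
  assumes \<rho>: "complex_measure M (\<lambda>E. complex_of_real (\<rho> E))" and s: "simple_function M s"
  shows "(LINT w|positive_part M \<rho>. s w)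
    = (\<Sum>y\<in>s ` space M. complex_of_real (measure (positive_part M \<rho>) (s -` {y} \<inter> space M)) * y)"
proof -
  interpret finite_measure "positive_part M \<rho>" by (rule finite_measure_positive_part[OF \<rho>])
  have "simple_function (positive_part M \<rho>) s"
    using s by (simp add: simple_function_def)
  \<comment> \<open>The support of \<open>s\<close> has finite measure because the whole space
    does.\<close>
  then have "Bochner_Integration.simple_bochner_integrable (positive_part M \<rho>) s"
    by (rule simple_bochner_integrable.intros) simp
  then have "(LINT w|positive_part M \<rho>. s w) = Bochner_Integration.simple_bochner_integral (positive_part M \<rho>) s"
    by (rule simple_bochner_integrable_eq_integral[symmetric])
  moreover have "{w \<in> space M. s w = y} = s -` {y} \<inter> space M" for y by auto
  ultimately show ?thesis
    by (simp add: simple_bochner_integral_def scaleR_conv_of_real)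
qed

text \<open>On each level set of \<open>s\<close> the four Jordan parts recombine to the value of
  \<open>\<nu>\<close>. In this form linearity and setwise continuity in the measure are visible, as
  needed for the functionals on the dual.\<close>

lemma complex_measure_integral_simple:
  assumes \<nu>: "complex_measure M \<nu>" and s: "simple_function M s"
  shows "complex_measure_integral M \<nu> s = (\<Sum>y\<in>s ` space M. \<nu> (s -` {y} \<inter> space M) * y)"
proof -
  note R = complex_measure_Re[OF \<nu>] and I = complex_measure_Im[OF \<nu>]
  have nR: "complex_measure M (\<lambda>E. complex_of_real (- Re (\<nu> E)))"
    using complex_measure_uminus[OF R] by simp
  have nI: "complex_measure M (\<lambda>E. complex_of_real (- Im (\<nu> E)))"
    using complex_measure_uminus[OF I] by simp
  let ?P = "\<lambda>\<rho> y. complex_of_real (measure (positive_part M \<rho>) (s -` {y} \<inter> space M))"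
  have "\<nu> (s -` {y} \<inter> space M) * y
      = (?P (\<lambda>E. Re (\<nu> E)) y * y - ?P (\<lambda>E. - Re (\<nu> E)) y * y)
        + \<i> * (?P (\<lambda>E. Im (\<nu> E)) y * y - ?P (\<lambda>E. - Im (\<nu> E)) y * y)" for y
  proof -
    have E: "s -` {y} \<inter> space M \<in> sets M" using simple_functionD(2)[OF s] .
    have "\<nu> (s -` {y} \<inter> space M) * y
      = ((?P (\<lambda>E. Re (\<nu> E)) y - ?P (\<lambda>E. - Re (\<nu> E)) y)
        + \<i> * (?P (\<lambda>E. Im (\<nu> E)) y - ?P (\<lambda>E. - Im (\<nu> E)) y)) * y"
      unfolding of_real_diff[symmetric] positive_part_diff[OF R E] positive_part_diff[OF I E]
        complex_eq[symmetric] ..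
    also have "\<dots> = (?P (\<lambda>E. Re (\<nu> E)) y * y - ?P (\<lambda>E. - Re (\<nu> E)) y * y)
        + \<i> * (?P (\<lambda>E. Im (\<nu> E)) y * y - ?P (\<lambda>E. - Im (\<nu> E)) y * y)"
      by algebra
    finally show ?thesis .
  qed
  then have "(\<Sum>y\<in>s ` space M. \<nu> (s -` {y} \<inter> space M) * y)
      = (\<Sum>y\<in>s ` space M. (?P (\<lambda>E. Re (\<nu> E)) y * y - ?P (\<lambda>E. - Re (\<nu> E)) y * y)
        + \<i> * (?P (\<lambda>E. Im (\<nu> E)) y * y - ?P (\<lambda>E. - Im (\<nu> E)) y * y))"
    by (rule sum.cong[OF refl])
  then show ?thesis
    unfolding complex_measure_integral_def integral_positive_part_simple[OF R s]
      integral_positive_part_simple[OF I s] integral_positive_part_simple[OF nR s]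
      integral_positive_part_simple[OF nI s] sum.distrib sum_subtractf sum_distrib_left[symmetric]
    by (rule sym)
qed

section \<open>Dominated convergence for a single complex measure\<close>

lemma complex_measure_integral_dominated_convergence:
  assumes \<nu>: "complex_measure M \<nu>"
    and s: "\<And>n. s n \<in> borel_measurable M" and f: "f \<in> borel_measurable M"
    and lim: "\<And>w. w \<in> space M \<Longrightarrow> (\<lambda>n. s n w) \<longlonglongrightarrow> f w"
    and g: "(\<lambda>w. complex_of_real (g w)) \<in> borel_measurable M"
      "(\<integral>\<^sup>+w. ennreal (cmod (complex_of_real (g w))) \<partial>total_variation M \<nu>) < \<infinity>"
    and bound: "\<And>n w. w \<in> space M \<Longrightarrow> cmod (s n w) \<le> g w"
  shows "(\<lambda>n. complex_measure_integral M \<nu> (s n)) \<longlonglongrightarrow> complex_measure_integral M \<nu> f"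
proof -
  note R = complex_measure_Re[OF \<nu>] and I = complex_measure_Im[OF \<nu>]
  have nR: "complex_measure M (\<lambda>E. complex_of_real (- Re (\<nu> E)))"
    using complex_measure_uminus[OF R] by simp
  have nI: "complex_measure M (\<lambda>E. complex_of_real (- Im (\<nu> E)))"
    using complex_measure_uminus[OF I] by simp
  \<comment> \<open>One statement serves all four Jordan parts, with \<open>\<rho>\<close> standing
    for plus or minus the real or imaginary part of \<open>\<nu>\<close>.\<close>
  have "(\<lambda>n. LINT w|positive_part M \<rho>. s n w) \<longlonglongrightarrow> (LINT w|positive_part M \<rho>. f w)"
    if \<rho>: "complex_measure M (\<lambda>E. complex_of_real (\<rho> E))"
      and le: "\<And>E. E \<in> sets M \<Longrightarrow> \<bar>\<rho> E\<bar> \<le> cmod (\<nu> E)" for \<rho>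
  proof (rule integral_dominated_convergence[where w = g])
    show "integrable (positive_part M \<rho>) g"
      using integrable_positive_part[OF \<rho> \<nu> le g] by (simp only: complex_of_real_integrable_eq)
    show "f \<in> borel_measurable (positive_part M \<rho>)"
      using f by (simp cong: measurable_cong_sets)
    show "s n \<in> borel_measurable (positive_part M \<rho>)" for n
      using s by (simp cong: measurable_cong_sets)
    show "AE w in positive_part M \<rho>. (\<lambda>n. s n w) \<longlonglongrightarrow> f w"
      by (rule AE_I2) (simp add: lim)
    show "AE w in positive_part M \<rho>. cmod (s n w) \<le> g w" for n
      by (rule AE_I2) (simp add: bound)
  qed
  from this[OF R] this[OF I] this[OF nR] this[OF nI] show ?thesis
    unfolding complex_measure_integral_def
    by (intro tendsto_intros) (simp_all add: abs_Re_le_cmod abs_Im_le_cmod)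
qed

text \<open>The approximating functions do not depend on the measure.\<close>

lemma complex_measure_integral_simple_approximation:
  fixes f :: "'w \<Rightarrow> complex"
  assumes f: "f \<in> borel_measurable M"
  obtains s :: "nat \<Rightarrow> 'w \<Rightarrow> complex" where "\<And>i. simple_function M (s i)"
    and "\<And>\<nu>. complex_measure M \<nu> \<Longrightarrow> (\<integral>\<^sup>+w. ennreal (cmod (f w)) \<partial>total_variation M \<nu>) < \<infinity> \<Longrightarrow>
      (\<lambda>i. \<Sum>y\<in>s i ` space M. \<nu> (s i -` {y} \<inter> space M) * y) \<longlonglongrightarrow> complex_measure_integral M \<nu> f"
proof -
  \<comment> \<open>The approximants satisfy \<open>cmod (s i w) \<le> 2 * cmod (f w)\<close>, so
    twice the modulus of \<open>f\<close> is the dominating function below.\<close>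
  obtain s where s: "\<And>i. simple_function M (s i)" 
    and lim: "\<And>w. w \<in> space M \<Longrightarrow> (\<lambda>i. s i w) \<longlonglongrightarrow> f w"
    and bound: "\<And>i w. w \<in> space M \<Longrightarrow> dist (s i w) 0 \<le> 2 * dist (f w) 0"
    using borel_measurable_implies_sequence_metric[OF f, of 0] by blast
  have "(\<lambda>i. \<Sum>y\<in>s i ` space M. \<nu> (s i -` {y} \<inter> space M) * y) \<longlonglongrightarrow> complex_measure_integral M \<nu> f"
    if \<nu>: "complex_measure M \<nu>"
      and fin: "(\<integral>\<^sup>+w. ennreal (cmod (f w)) \<partial>total_variation M \<nu>) < \<infinity>" for \<nu>
  proof -
    have "(\<lambda>i. complex_measure_integral M \<nu> (s i)) \<longlonglongrightarrow> complex_measure_integral M \<nu> f"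
    proof (rule complex_measure_integral_dominated_convergence[OF \<nu> borel_measurable_simple_function[OF s] f lim])
      show "(\<lambda>w. complex_of_real (2 * cmod (f w))) \<in> borel_measurable M"
        using f by measurable
      have "f \<in> borel_measurable (total_variation M \<nu>)"
        using f by (simp cong: measurable_cong_sets)
      then have "(\<integral>\<^sup>+w. ennreal (cmod (complex_of_real (2 * cmod (f w)))) \<partial>total_variation M \<nu>)
          = 2 * (\<integral>\<^sup>+w. ennreal (cmod (f w)) \<partial>total_variation M \<nu>)"
        by (subst nn_integral_cmult[symmetric]) (auto simp: ennreal_mult norm_mult)
      then show "(\<integral>\<^sup>+w. ennreal (cmod (complex_of_real (2 * cmod (f w)))) \<partial>total_variation M \<nu>) < \<infinity>"
        using fin by (simp add: ennreal_mult_less_top)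
    qed (use bound in auto)
    then show ?thesis by (simp add: complex_measure_integral_simple[OF \<nu> s])
  qed
  with s show ?thesis using that by blast
qed

section \<open>The uniform boundedness principle on a closed subspace\<close>

text \<open>Baire's theorem in the complete space \<open>S\<close> yields a relative ball on which
  all \<open>T n\<close> share a bound; linearity spreads it to \<open>S\<close>. The maps are
  required to be linear and continuous only on \<open>S\<close>, since the intended \<open>S\<close>
  is \<open>cdual\<close>, a set rather than a type.\<close>

lemma uniform_boundedness_on_subspace:
  fixes S :: "'a::banach set" and T :: "nat \<Rightarrow> 'a \<Rightarrow> 'b::real_normed_vector"
  assumes S: "subspace S" "closed S"
    and add: "\<And>n x y. x \<in> S \<Longrightarrow> y \<in> S \<Longrightarrow> T n (x + y) = T n x + T n y"
    and scale: "\<And>n c x. x \<in> S \<Longrightarrow> T n (c *\<^sub>R x) = c *\<^sub>R T n x"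
    and cont: "\<And>n. continuous_on S (T n)"
    and bdd: "\<And>x. x \<in> S \<Longrightarrow> Bseq (\<lambda>n. T n x)"
  obtains K where "\<And>n x. x \<in> S \<Longrightarrow> norm (T n x) \<le> K * norm x"
proof -
  define C where "C m = {x \<in> S. \<forall>n. norm (T n x) \<le> real m}" for m :: nat
  let ?X = "top_of_set S"
  have closed: "closedin ?X (C m)" for m
  proof -
    have "C m = (\<Inter>n. S \<inter> T n -` cball 0 (real m))" by (auto simp: C_def)
    moreover have "closedin ?X (S \<inter> T n -` cball 0 (real m))" for n
      using cont by (intro continuous_closedin_preimage) auto
    ultimately show ?thesis by (auto intro: closedin_INT simp del: INT_simps)
  qed
  have "(\<Union>m. C m) = S"
  proof (intro antisym subsetI)
    fix x assume x: "x \<in> S"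
    then obtain K where "\<And>n. norm (T n x) \<le> K" using bdd[OF x] by (auto simp: Bseq_def)
    moreover obtain m where "K \<le> real m" using real_arch_simple by blast
    ultimately have "x \<in> C m" using x by (auto simp: C_def intro: order_trans)
    then show "x \<in> (\<Union>m. C m)" by blast
  qed (auto simp: C_def)
  \<comment> \<open>The union of the sets \<open>C m\<close> thus has nonempty relative interior, so
    by Baire some single \<open>C m\<close> has one as well.\<close>
  moreover have "0 \<in> ?X interior_of S"
    using interior_of_topspace[of ?X] subspace_0[OF S(1)] by simp
  ultimately have "?X interior_of \<Union>(range C) \<noteq> {}" by auto
  moreover have "completely_metrizable_space ?X"
    using S(2) by (intro completely_metrizable_space_closedin completely_metrizable_space_euclidean) simp
  ultimately have "\<not> (\<forall>A\<in>range C. closedin ?X A \<and> ?X interior_of A = {})"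
    using Baire_category_alt[of ?X "range C"] by auto
  then obtain m where "?X interior_of C m \<noteq> {}"
    using closed by auto
  then obtain a where a: "a \<in> ?X interior_of C m" by blast
  moreover have "openin ?X (?X interior_of C m)" by simp
  ultimately obtain e where e: "e > 0" "ball a e \<inter> S \<subseteq> ?X interior_of C m"
    unfolding openin_contains_ball by blast
  then have ball: "ball a e \<inter> S \<subseteq> C m" using interior_of_subset order_trans by metis
  have aC: "a \<in> C m" by (rule subsetD[OF interior_of_subset a])
  have "norm (T n x) \<le> (4 * real m / e) * norm x" if x: "x \<in> S" for n x
  proof (cases "x = 0")
    case True
    then show ?thesis using scale[OF x, of n 0] by simp
  next
    case False
    \<comment> \<open>The vector \<open>c *\<^sub>R x\<close> has norm \<open>e / 2\<close>, so
      \<open>a + c *\<^sub>R x\<close> stays in the ball around \<open>a\<close>. Subtracting the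
      value at \<open>a\<close> gives the bound \<open>2 * real m\<close>, and dividing by
      \<open>c\<close> gives the constant \<open>4 * real m / e\<close>.\<close>
    define c where "c = e / (2 * norm x)"
    have c: "c > 0" using False e by (simp add: c_def)
    have cx: "c *\<^sub>R x \<in> S" using x S(1) by (simp add: subspace_scale)
    have aS: "a \<in> S" using aC by (simp add: C_def)
    have "dist a (a + c *\<^sub>R x) = e / 2"
      using False e by (simp add: dist_norm c_def)
    then have "a + c *\<^sub>R x \<in> C m"
      using ball e(1) aS cx S(1) by (auto simp: subspace_add)
    then have "norm (T n (a + c *\<^sub>R x)) \<le> m" "norm (T n a) \<le> m" using aC by (auto simp: C_def)
    moreover have "c *\<^sub>R T n x = T n (a + c *\<^sub>R x) - T n a"
      by (simp add: add[OF aS cx] scale[OF x])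
    ultimately have "norm (c *\<^sub>R T n x) \<le> 2 * real m"
      using norm_triangle_ineq4[of "T n (a + c *\<^sub>R x)" "T n a"] by simp
    then have "c * norm (T n x) \<le> 2 * real m" using c by simp
    then have "norm (T n x) \<le> 2 * real m / c" using c by (simp add: field_simps)
    also have "\<dots> = (4 * real m / e) * norm x" by (simp add: c_def)
    finally show ?thesis .
  qed
  then show ?thesis using that by blast
qed


section \<open>The dual as a closed subspace, and integrals as elements of the bidual\<close>

lemma subspace_cdual: "subspace cdual"
  by (auto simp: subspace_def cdual_def blinfun.add_left blinfun.scaleR_left algebra_simps)

lemma cdual_scale_in_cdual: "\<Lambda> \<in> cdual \<Longrightarrow> cdual_scale c \<Lambda> \<in> cdual"
  by (simp add: cdual_def cdual_scale_apply)

lemma cdual_scale_of_real: "cdual_scale (complex_of_real r) \<Lambda> = r *\<^sub>R \<Lambda>"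
  by (rule blinfun_eqI) (simp add: cdual_scale_apply blinfun.scaleR_left scaleR_conv_of_real)

text \<open>Evaluation at a point is continuous in the operator norm, so each linearity equation
  cuts out a closed set.\<close>

lemma closed_cdual: "closed (cdual :: ('a::complex_banach \<Rightarrow>\<^sub>L complex) set)"
proof -
  have "closed {\<Lambda> :: 'a \<Rightarrow>\<^sub>L complex. \<Lambda> (c *\<^sub>C x) = c * \<Lambda> x}" for c x
    by (intro closed_Collect_eq continuous_intros)
  then have "closed (\<Inter>c. \<Inter>x. {\<Lambda> :: 'a \<Rightarrow>\<^sub>L complex. \<Lambda> (c *\<^sub>C x) = c * \<Lambda> x})"
    by (intro closed_INT ballI)
  also have "(\<Inter>c. \<Inter>x. {\<Lambda> :: 'a \<Rightarrow>\<^sub>L complex. \<Lambda> (c *\<^sub>C x) = c * \<Lambda> x}) = cdual"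
    by (auto simp: cdual_def)
  finally show ?thesis .
qed

text \<open>Weak-* convergence takes place inside \<open>cbidual\<close>, so membership is needed
  for the limit and for the members of the sequence; hence the statement for arbitrary
  \<open>f\<close> in \<open>L1_family\<close>.\<close>

lemma family_integral_in_cbidual:
  fixes \<mu> :: "('a::complex_banach \<Rightarrow>\<^sub>L complex) \<Rightarrow> 'a \<Rightarrow> 'w set \<Rightarrow> complex"
  assumes \<mu>: "operator_projection_family M \<mu>" and f: "f \<in> L1_family M \<mu>"
  shows "family_integral M \<mu> f x \<in> cbidual"
proof -
  obtain s :: "nat \<Rightarrow> 'w \<Rightarrow> complex" where s: "\<And>i. simple_function M (s i)"
    and lim: "\<And>\<nu>. complex_measure M \<nu> \<Longrightarrow> (\<integral>\<^sup>+w. ennreal (cmod (f w)) \<partial>total_variation M \<nu>) < \<infinity> \<Longrightarrow>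
      (\<lambda>i. \<Sum>y\<in>s i ` space M. \<nu> (s i -` {y} \<inter> space M) * y) \<longlonglongrightarrow> complex_measure_integral M \<nu> f"
    using complex_measure_integral_simple_approximation[of f M] f by (auto simp: L1_family_def)
  \<comment> \<open>\<open>T i \<Lambda>\<close> is the integral of the simple function
    \<open>s i\<close> with respect to \<open>\<mu> \<Lambda> x\<close>.\<close>
  define T where "T i \<Lambda> = (\<Sum>y\<in>s i ` space M. \<mu> \<Lambda> x (s i -` {y} \<inter> space M) * y)" for i \<Lambda>
  define I where "I \<Lambda> = complex_measure_integral M (\<mu> \<Lambda> x) f" for \<Lambda>
  have meas: "s i -` {y} \<inter> space M \<in> sets M" for i y
    using simple_functionD(2)[OF s] .
  have T_lim: "(\<lambda>i. T i \<Lambda>) \<longlonglongrightarrow> I \<Lambda>" if "\<Lambda> \<in> cdual" for \<Lambda>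
    unfolding T_def I_def using \<mu> f that
    by (intro lim) (auto simp: operator_projection_family_def L1_family_def)
  have T_add: "T i (\<Lambda> + \<Lambda>') = T i \<Lambda> + T i \<Lambda>'" if "\<Lambda> \<in> cdual" "\<Lambda>' \<in> cdual" for i \<Lambda> \<Lambda>'
  proof -
    have "\<mu> (\<Lambda> + \<Lambda>') x E = \<mu> \<Lambda> x E + \<mu> \<Lambda>' x E" if "E \<in> sets M" for E
      using \<mu> \<open>\<Lambda> \<in> cdual\<close> \<open>\<Lambda>' \<in> cdual\<close> that by (simp add: operator_projection_family_def)
    then show ?thesis by (simp add: T_def meas sum.distrib algebra_simps)
  qed
  have T_scale: "T i (cdual_scale c \<Lambda>) = c * T i \<Lambda>" if "\<Lambda> \<in> cdual" for i c \<Lambda>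
  proof -
    have "\<mu> (cdual_scale c \<Lambda>) x E = c * \<mu> \<Lambda> x E" if "E \<in> sets M" for E
      using \<mu> \<open>\<Lambda> \<in> cdual\<close> that by (simp add: operator_projection_family_def)
    then show ?thesis by (simp add: T_def meas sum_distrib_left mult.assoc)
  qed
  \<comment> \<open>For fixed \<open>i\<close> only finitely many measurable sets enter
    \<open>T i\<close>, so setwise convergence suffices.\<close>
  have T_cont: "continuous_on cdual (T i)" for i
    unfolding continuous_on_def
  proof
    fix \<Lambda> :: "'a \<Rightarrow>\<^sub>L complex" assume \<Lambda>: "\<Lambda> \<in> cdual"
    have "setwise_tendsto M (\<lambda>\<Lambda>'. \<mu> \<Lambda>' x) (\<mu> \<Lambda> x) (at \<Lambda> within cdual)"
      by (rule operator_projection_family_net_dual[OF \<mu> _ \<Lambda>])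
        (auto simp: eventually_at_topological)
    then show "(T i \<longlongrightarrow> T i \<Lambda>) (at \<Lambda> within cdual)"
      unfolding T_def using meas
      by (intro tendsto_sum tendsto_mult tendsto_const) (auto simp: setwise_tendsto_def)
  qed
  obtain K where K: "\<And>i \<Lambda>. \<Lambda> \<in> cdual \<Longrightarrow> norm (T i \<Lambda>) \<le> K * norm \<Lambda>"
  proof (rule uniform_boundedness_on_subspace[of cdual T])
    show "T i (c *\<^sub>R \<Lambda>) = c *\<^sub>R T i \<Lambda>" if "\<Lambda> \<in> cdual" for i c \<Lambda>
      using T_scale[OF that, of i "complex_of_real c"]
      by (simp add: cdual_scale_of_real scaleR_conv_of_real)
    \<comment> \<open>Pointwise boundedness comes from pointwise convergence to
      \<open>I\<close>.\<close>
    show "Bseq (\<lambda>i. T i \<Lambda>)" if "\<Lambda> \<in> cdual" for \<Lambda>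
      using T_lim[OF that] by (intro convergent_imp_Bseq convergentI)
  qed (use subspace_cdual closed_cdual T_add T_cont in auto)
  \<comment> \<open>Jordan parts do not depend additively on the measure; linearity of
    \<open>I\<close> is therefore inherited from \<open>T i\<close> in the limit.\<close>
  have I_add: "I (\<Lambda> + \<Lambda>') = I \<Lambda> + I \<Lambda>'" if \<Lambda>: "\<Lambda> \<in> cdual" "\<Lambda>' \<in> cdual" for \<Lambda> \<Lambda>'
    using tendsto_add[OF T_lim[OF \<Lambda>(1)] T_lim[OF \<Lambda>(2)]]
      T_lim[OF subspace_add[OF subspace_cdual \<Lambda>]]
    unfolding T_add[OF \<Lambda>] by (rule LIMSEQ_unique[symmetric])
  have I_scale: "I (cdual_scale c \<Lambda>) = c * I \<Lambda>" if \<Lambda>: "\<Lambda> \<in> cdual" for c \<Lambda>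
    using tendsto_mult_left[OF T_lim[OF \<Lambda>], of c] T_lim[OF cdual_scale_in_cdual[OF \<Lambda>], of c]
    unfolding T_scale[OF \<Lambda>] by (rule LIMSEQ_unique[symmetric])
  have I_bound: "cmod (I \<Lambda>) \<le> K * norm \<Lambda>" if "\<Lambda> \<in> cdual" for \<Lambda>
    using tendsto_norm[OF T_lim[OF that]] by (rule LIMSEQ_le_const2) (use K that in blast)
  have "family_integral M \<mu> f x = restrict I cdual"
    by (simp add: family_integral_def I_def[abs_def])
  moreover have "\<exists>K. \<forall>\<Lambda>\<in>cdual. cmod (I \<Lambda>) \<le> K * norm \<Lambda>"
    using I_bound by blast
  ultimately show ?thesis
    using I_add I_scale
    by (simp add: cbidual_def subspace_add[OF subspace_cdual] cdual_scale_in_cdual)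
qed

section \<open>Weak-* convergence of the integrals\<close>

theorem mainTheorem5:
  fixes M :: "'w measure"
    and \<mu> :: "('a::complex_banach \<Rightarrow>\<^sub>L complex) \<Rightarrow> 'a \<Rightarrow> 'w set \<Rightarrow> complex"
    and fs :: "nat \<Rightarrow> 'w \<Rightarrow> complex" and f :: "'w \<Rightarrow> complex" and g :: "'w \<Rightarrow> real"
  assumes "operator_projection_family M \<mu>"
    and "\<And>n. fs n \<in> L1_family M \<mu>"
    and "\<And>w. w \<in> space M \<Longrightarrow> (\<lambda>n. fs n w) \<longlonglongrightarrow> f w"
    and "(\<lambda>w. complex_of_real (g w)) \<in> L1_family M \<mu>"
    and "\<And>n w. w \<in> space M \<Longrightarrow> cmod (fs n w) \<le> g w"
  shows "f \<in> L1_family M \<mu> \<and>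
    (\<forall>x. limitin weak_star_topology (\<lambda>n. family_integral M \<mu> (fs n) x)
           (family_integral M \<mu> f x) sequentially)"
proof (intro conjI allI)
  have fs: "fs n \<in> borel_measurable M" for n
    using assms(2) by (simp add: L1_family_def)
  have f: "f \<in> borel_measurable M"
    by (rule borel_measurable_LIMSEQ_metric[OF fs assms(3)])
  \<comment> \<open>The bound by \<open>g\<close> passes to the pointwise limit and makes
    \<open>f\<close> integrable for every member of the family.\<close>
  have le: "cmod (f w) \<le> g w" if "w \<in> space M" for w
    using tendsto_norm[OF assms(3)[OF that]] by (rule LIMSEQ_le_const2) (use assms(5) that in blast)
  have "(\<integral>\<^sup>+w. ennreal (cmod (f w)) \<partial>total_variation M (\<mu> \<Lambda> x)) < \<infinity>" if "\<Lambda> \<in> cdual" for \<Lambda> x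
  proof (rule order_le_less_trans)
    show "(\<integral>\<^sup>+w. ennreal (cmod (f w)) \<partial>total_variation M (\<mu> \<Lambda> x))
        \<le> (\<integral>\<^sup>+w. ennreal (cmod (complex_of_real (g w))) \<partial>total_variation M (\<mu> \<Lambda> x))"
      using le by (intro nn_integral_mono ennreal_leI) (force simp: total_variation_def)
    show "\<dots> < \<infinity>" using assms(4) that by (auto simp: L1_family_def)
  qed
  with f show fL1: "f \<in> L1_family M \<mu>" by (simp add: L1_family_def)
  fix x
  have "(\<lambda>n. complex_measure_integral M (\<mu> \<Lambda> x) (fs n)) \<longlonglongrightarrow> complex_measure_integral M (\<mu> \<Lambda> x) f"
    if "\<Lambda> \<in> cdual" for \<Lambda>
    using assms(1,4) that
    by (intro complex_measure_integral_dominated_convergence[OF _ fs f assms(3) _ _ assms(5)])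
      (auto simp: L1_family_def operator_projection_family_def)
  \<comment> \<open>Convergence in the product is convergence at each \<open>\<Lambda>\<close> in
    \<open>cdual\<close>; passing to the subtopology then only adds membership in
    \<open>cbidual\<close>.\<close>
  then have "limitin (product_topology (\<lambda>_. euclidean) cdual)
      (\<lambda>n. family_integral M \<mu> (fs n) x) (family_integral M \<mu> f x) sequentially"
    by (simp add: limitin_componentwise family_integral_def)
  then show "limitin weak_star_topology (\<lambda>n. family_integral M \<mu> (fs n) x)
      (family_integral M \<mu> f x) sequentially"
    unfolding weak_star_topology_def limitin_subtopology
    using family_integral_in_cbidual[OF assms(1)] fL1 assms(2) by simp
qed

end
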